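(* If $n$ is a positive integer divisible by $8$, then $\mathrm{ex}^*(n, C_4, P_4) = 3n$.
   Context: An edge-coloring is proper if any two edges sharing a vertex receive different colors. An edge-colored subgraph is rainbow if no two of its edges have the same color. $P_4$ denotes the path with $4$ edges and $C_4$ the cycle of length $4$. $\mathrm{ex}^*(n,H,F)$ is the maximum number of rainbow copies of $H$ (as subgraphs) in an $n$-vertex simple graph with a proper edge-coloring containing no rainbow copy of $F$. *)

theory Defs
  imports Main
begin

text \<open>A graph is a pair of a vertex set and a set of edges, each edge being a two-element set of
  vertices.\<close>

type_synonym 'a graph = "'a set \<times> 'a set set"

abbreviation verts :: "'a graph \<Rightarrow> 'a set" where
  "verts \<equiv> fst"

abbreviation edges :: "'a graph \<Rightarrow> 'a set set" where
  "edges \<equiv> snd"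

definition simple_graph :: "'a graph \<Rightarrow> bool" where
  "simple_graph G \<longleftrightarrow> finite (verts G) \<and> (\<forall>e\<in>edges G. e \<subseteq> verts G \<and> card e = 2)"

definition subgraph :: "'a graph \<Rightarrow> 'a graph \<Rightarrow> bool" where
  "subgraph K G \<longleftrightarrow> simple_graph K \<and> verts K \<subseteq> verts G \<and> edges K \<subseteq> edges G"

definition isomorphic :: "'a graph \<Rightarrow> 'b graph \<Rightarrow> bool" where
  "isomorphic H K \<longleftrightarrow> (\<exists>f. bij_betw f (verts H) (verts K) \<and> edges K = (\<lambda>e. f ` e) ` edges H)"

text \<open>The index \<open>k\<close> counts edges in both cases, so \<open>path_graph k\<close> has \<open>k + 1\<close> vertices;
  \<open>cycle_graph k\<close> is a cycle only for \<open>k \<ge> 3\<close>.\<close>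

definition path_graph :: "nat \<Rightarrow> nat graph" where
  "path_graph k = ({0..k}, {{i, i + 1} | i. i < k})"

definition cycle_graph :: "nat \<Rightarrow> nat graph" where
  "cycle_graph k = ({0..<k}, {{i, (i + 1) mod k} | i. i < k})"

definition proper_edge_coloring :: "'a graph \<Rightarrow> ('a set \<Rightarrow> 'c) \<Rightarrow> bool" where
  "proper_edge_coloring G c \<longleftrightarrow>
     (\<forall>e\<in>edges G. \<forall>e'\<in>edges G. e \<noteq> e' \<and> e \<inter> e' \<noteq> {} \<longrightarrow> c e \<noteq> c e')"

definition rainbow :: "('a set \<Rightarrow> 'c) \<Rightarrow> 'a graph \<Rightarrow> bool" where
  "rainbow c K \<longleftrightarrow> inj_on c (edges K)"

definition rainbow_copies :: "'a graph \<Rightarrow> ('a set \<Rightarrow> 'c) \<Rightarrow> 'b graph \<Rightarrow> 'a graph set" where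
  "rainbow_copies G c H = {K. subgraph K G \<and> isomorphic H K \<and> rainbow c K}"

text \<open>Taking vertices and colors in \<open>nat\<close> loses no generality, since every graph considered has
  finitely many vertices and edges.\<close>

definition ex_star_values :: "nat \<Rightarrow> 'a graph \<Rightarrow> 'b graph \<Rightarrow> nat set" where
  "ex_star_values n H F =
     {card (rainbow_copies G c H) | (G :: nat graph) (c :: nat set \<Rightarrow> nat).
        simple_graph G \<and> card (verts G) = n \<and> proper_edge_coloring G c
        \<and> rainbow_copies G c F = {}}"

definition ex_star :: "nat \<Rightarrow> 'a graph \<Rightarrow> 'b graph \<Rightarrow> nat" where
  "ex_star n H F = Max (ex_star_values n H F)"

lemma card_rainbow_copies_le:
  assumes "simple_graph G"
  shows "card (rainbow_copies G c H) \<le> 2 ^ card (verts G) * 2 ^ 2 ^ card (verts G)"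
proof -
  have fin: "finite (verts G)"
    using assms by (simp add: simple_graph_def)
  have "rainbow_copies G c H \<subseteq> Pow (verts G) \<times> Pow (Pow (verts G))"
    using assms by (fastforce simp: rainbow_copies_def subgraph_def simple_graph_def)
  then have "card (rainbow_copies G c H) \<le> card (Pow (verts G) \<times> Pow (Pow (verts G)))"
    using fin by (intro card_mono) auto
  then show ?thesis
    using fin by (simp add: card_cartesian_product card_Pow)
qed

text \<open>Hence the maximum defining \<^const>\<open>ex_star\<close> is attained as soon as some graph is
  admissible.\<close>

lemma finite_ex_star_values: "finite (ex_star_values n H F)"
  by (rule finite_subset[of _ "{..2 ^ n * 2 ^ 2 ^ n}"])
     (auto simp: ex_star_values_def intro: card_rainbow_copies_le[THEN order_trans])

end

theory Submission
  imports Defs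
begin

text \<open>Upper bound: no vertex \<open>a\<close> lies on more than 12 rainbow 4-cycles; double counting then
  gives \<open>12n / 4 = 3n\<close>. Since there is no rainbow path with 4 edges, an edge from \<open>a\<close> that leaves a
  rainbow 4-cycle \<open>a b d e\<close> has the colour of \<open>bd\<close> or of \<open>de\<close>. So \<open>a\<close> has degree at most 5, and at
  most 4 unless \<open>ad\<close> is an edge. If \<open>a b w e\<close> is another rainbow 4-cycle, the same observation at
  \<open>b\<close> and \<open>e\<close> forces \<open>bw\<close> to have the colour of \<open>de\<close> and \<open>ew\<close> that of \<open>bd\<close>; so each pair of
  neighbours \<open>b, e\<close> of \<open>a\<close> is on at most two rainbow 4-cycles through \<open>a\<close>, and on at most one when
  \<open>a\<close> is adjacent to every opposite vertex. The bound is \<open>6 * 2\<close> if the degree is at most 4 and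
  \<open>10 * 1\<close> if it is 5.

  Lower bound: take disjoint copies of \<open>K\<^sub>4\<^sub>,\<^sub>4\<close> with both sides labelled by the group
  \<open>Z\<^sub>2 \<times> Z\<^sub>2\<close>, colouring an edge by the sum of its labels. The colours along a path with 4 edges
  add up to the sum of the two end labels, while all four group elements add up to 0; so a rainbow
  path would be closed. Each copy has 24 rainbow 4-cycles.\<close>

section \<open>4-cycles and paths with 4 edges as tuples of vertices\<close>

definition cycle4 :: "'a \<Rightarrow> 'a \<Rightarrow> 'a \<Rightarrow> 'a \<Rightarrow> 'a graph" where
  "cycle4 a b d e = ({a, b, d, e}, {{a, b}, {b, d}, {d, e}, {e, a}})"

definition path4 :: "'a \<Rightarrow> 'a \<Rightarrow> 'a \<Rightarrow> 'a \<Rightarrow> 'a \<Rightarrow> 'a graph" where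
  "path4 a b d e f = ({a, b, d, e, f}, {{a, b}, {b, d}, {d, e}, {e, f}})"

lemma cycle_graph_4: "cycle_graph 4 = cycle4 0 1 2 3"
proof -
  have *: "{0..<4} = {0, 1, 2, 3::nat}"
    by auto
  have "{{i, (i + 1) mod 4} | i. i < 4} = (\<lambda>i. {i, (i + 1) mod 4}) ` {0..<4::nat}"
    by auto
  then show ?thesis
    unfolding cycle_graph_def cycle4_def * image_insert image_empty
    by (simp add: insert_commute flip: numeral_2_eq_2)
qed

lemma path_graph_4: "path_graph 4 = path4 0 1 2 3 4"
proof -
  have *: "{0..4} = {0, 1, 2, 3, 4::nat}" "{0..<4} = {0, 1, 2, 3::nat}"
    by auto
  have "{{i, i + 1} | i. i < 4} = (\<lambda>i. {i, i + 1}) ` {0..<4::nat}"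
    by auto
  then show ?thesis
    unfolding path_graph_def path4_def * image_insert image_empty
    by (simp flip: numeral_2_eq_2)
qed

lemma isomorphic_cycle4_iff:
  "isomorphic (cycle_graph 4) K \<longleftrightarrow>
    (\<exists>a b d e. distinct [a, b, d, e] \<and> K = cycle4 a b d e)"
proof
  assume "isomorphic (cycle_graph 4) K"
  then obtain g where g: "bij_betw g {0, 1, 2, 3::nat} (verts K)"
    "edges K = (\<lambda>e. g ` e) ` edges (cycle4 0 1 2 3)"
    by (auto simp: isomorphic_def cycle_graph_4 cycle4_def)
  then have "distinct [g 0, g 1, g 2, g 3]"
    by (simp add: bij_betw_def)
  moreover have "K = cycle4 (g 0) (g 1) (g 2) (g 3)"
    using g bij_betw_imp_surj_on[OF g(1)] by (simp add: cycle4_def prod_eq_iff)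
  ultimately show "\<exists>a b d e. distinct [a, b, d, e] \<and> K = cycle4 a b d e"
    by blast
next
  assume "\<exists>a b d e. distinct [a, b, d, e] \<and> K = cycle4 a b d e"
  then obtain a b d e where K: "distinct [a, b, d, e]" "K = cycle4 a b d e"
    by blast
  then have "bij_betw ((!) [a, b, d, e]) {0, 1, 2, 3} (verts K)"
    by (intro bij_betw_nth) (auto simp: cycle4_def)
  with K show "isomorphic (cycle_graph 4) K"
    unfolding isomorphic_def cycle_graph_4
    by (intro exI[of _ "(!) [a, b, d, e]"]) (simp add: cycle4_def numeral_eq_Suc)
qed

lemma isomorphic_path4_iff:
  "isomorphic (path_graph 4) K \<longleftrightarrow>
    (\<exists>a b d e f. distinct [a, b, d, e, f] \<and> K = path4 a b d e f)"
proof
  assume "isomorphic (path_graph 4) K"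
  then obtain g where g: "bij_betw g {0, 1, 2, 3, 4::nat} (verts K)"
    "edges K = (\<lambda>e. g ` e) ` edges (path4 0 1 2 3 4)"
    by (auto simp: isomorphic_def path_graph_4 path4_def)
  then have "distinct [g 0, g 1, g 2, g 3, g 4]"
    by (simp add: bij_betw_def)
  moreover have "K = path4 (g 0) (g 1) (g 2) (g 3) (g 4)"
    using g bij_betw_imp_surj_on[OF g(1)] by (simp add: path4_def prod_eq_iff)
  ultimately show "\<exists>a b d e f. distinct [a, b, d, e, f] \<and> K = path4 a b d e f"
    by blast
next
  assume "\<exists>a b d e f. distinct [a, b, d, e, f] \<and> K = path4 a b d e f"
  then obtain a b d e f where K: "distinct [a, b, d, e, f]" "K = path4 a b d e f"
    by blast
  then have "bij_betw ((!) [a, b, d, e, f]) {0, 1, 2, 3, 4} (verts K)"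
    by (intro bij_betw_nth) (auto simp: path4_def)
  with K show "isomorphic (path_graph 4) K"
    unfolding isomorphic_def path_graph_4
    by (intro exI[of _ "(!) [a, b, d, e, f]"]) (simp add: path4_def numeral_eq_Suc)
qed

text \<open>The tuple is cyclic: \<open>b\<close> and \<open>e\<close> are the neighbours of
  \<open>a\<close> on the cycle and \<open>d\<close> is opposite to \<open>a\<close>. Rotations and
  reflections make eight such tuples describe one cycle.\<close>

definition rainbow_C4 :: "'a graph \<Rightarrow> ('a set \<Rightarrow> 'c) \<Rightarrow> 'a \<Rightarrow> 'a \<Rightarrow> 'a \<Rightarrow> 'a \<Rightarrow> bool" where
  "rainbow_C4 G c a b d e \<longleftrightarrow> distinct [a, b, d, e] \<and> {{a, b}, {b, d}, {d, e}, {e, a}} \<subseteq> edges G \<and>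
     distinct [c {a, b}, c {b, d}, c {d, e}, c {e, a}]"

definition rainbow_P4 :: "'a graph \<Rightarrow> ('a set \<Rightarrow> 'c) \<Rightarrow> 'a \<Rightarrow> 'a \<Rightarrow> 'a \<Rightarrow> 'a \<Rightarrow> 'a \<Rightarrow> bool" where
  "rainbow_P4 G c a b d e f \<longleftrightarrow> distinct [a, b, d, e, f] \<and>
     {{a, b}, {b, d}, {d, e}, {e, f}} \<subseteq> edges G \<and>
     distinct [c {a, b}, c {b, d}, c {d, e}, c {e, f}]"

lemma rainbow_C4_rotate: "rainbow_C4 G c a b d e \<Longrightarrow> rainbow_C4 G c b d e a"
  by (auto simp: rainbow_C4_def)

lemma rainbow_C4_reflect: "rainbow_C4 G c a b d e \<Longrightarrow> rainbow_C4 G c a e d b"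
  by (auto simp: rainbow_C4_def insert_commute)

lemma cycle4_rotate: "cycle4 a b d e = cycle4 b d e a"
  by (auto simp: cycle4_def)

lemma cycle4_reflect: "cycle4 a b d e = cycle4 a e d b"
  by (auto simp: cycle4_def insert_commute)

lemma finite_rainbow_copies:
  assumes "simple_graph G"
  shows "finite (rainbow_copies G c H)"
proof (rule finite_subset)
  show "rainbow_copies G c H \<subseteq> Pow (verts G) \<times> Pow (Pow (verts G))"
    using assms by (fastforce simp: rainbow_copies_def subgraph_def simple_graph_def)
  show "finite (Pow (verts G) \<times> Pow (Pow (verts G)))"
    using assms by (simp add: simple_graph_def)
qed

lemma rainbow_copies_C4:
  assumes "simple_graph G"
  shows "rainbow_copies G c (cycle_graph 4) = {cycle4 a b d e | a b d e. rainbow_C4 G c a b d e}"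
proof -
  have "subgraph (cycle4 a b d e) G \<and> rainbow c (cycle4 a b d e) \<longleftrightarrow> rainbow_C4 G c a b d e"
    if d: "distinct [a, b, d, e]" for a b d e
  proof -
    have "rainbow c (cycle4 a b d e) \<longleftrightarrow> distinct [c {a, b}, c {b, d}, c {d, e}, c {e, a}]"
      using d by (auto simp: rainbow_def cycle4_def doubleton_eq_iff)
    moreover have "subgraph (cycle4 a b d e) G \<longleftrightarrow>
        {{a, b}, {b, d}, {d, e}, {e, a}} \<subseteq> edges G"
      using d assms by (auto simp: subgraph_def cycle4_def simple_graph_def)
    ultimately show ?thesis
      using d by (simp only: rainbow_C4_def) blast
  qed
  moreover have "distinct [a, b, d, e]" if "rainbow_C4 G c a b d e" for a b d e
    using that by (simp only: rainbow_C4_def)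
  ultimately show ?thesis
    unfolding rainbow_copies_def isomorphic_cycle4_iff by blast
qed

lemma rainbow_copies_P4_empty_iff:
  assumes "simple_graph G"
  shows "rainbow_copies G c (path_graph 4) = {} \<longleftrightarrow> (\<forall>a b d e f. \<not> rainbow_P4 G c a b d e f)"
proof -
  have "subgraph (path4 a b d e f) G \<and> rainbow c (path4 a b d e f) \<longleftrightarrow> rainbow_P4 G c a b d e f"
    if d: "distinct [a, b, d, e, f]" for a b d e f
  proof -
    have "rainbow c (path4 a b d e f) \<longleftrightarrow> distinct [c {a, b}, c {b, d}, c {d, e}, c {e, f}]"
      using d by (auto simp: rainbow_def path4_def doubleton_eq_iff)
    moreover have "subgraph (path4 a b d e f) G \<longleftrightarrow>
        {{a, b}, {b, d}, {d, e}, {e, f}} \<subseteq> edges G"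
      using d assms by (auto simp: subgraph_def path4_def simple_graph_def)
    ultimately show ?thesis
      using d by (simp only: rainbow_P4_def) blast
  qed
  moreover have "distinct [a, b, d, e, f]" if "rainbow_P4 G c a b d e f" for a b d e f
    using that by (simp only: rainbow_P4_def)
  ultimately show ?thesis
    unfolding rainbow_copies_def isomorphic_path4_iff by blast
qed

section \<open>Colours and degrees around a rainbow 4-cycle\<close>

locale rainbow_P4_free =
  fixes G :: "'a graph" and c :: "'a set \<Rightarrow> 'c"
  assumes simple: "simple_graph G"
    and proper: "proper_edge_coloring G c"
    and free: "rainbow_copies G c (path_graph 4) = {}"
begin

definition neighbours :: "'a \<Rightarrow> 'a set" where
  "neighbours a = {w. {a, w} \<in> edges G}"

definition rainbow_C4s_at :: "'a \<Rightarrow> 'a graph set" where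
  "rainbow_C4s_at a = {K \<in> rainbow_copies G c (cycle_graph 4). a \<in> verts K}"

lemma edge_neq: "{a, b} \<in> edges G \<Longrightarrow> a \<noteq> b"
  using simple by (fastforce simp: simple_graph_def)

lemma edge_in_verts: "{a, b} \<in> edges G \<Longrightarrow> a \<in> verts G \<and> b \<in> verts G"
  using simple by (fastforce simp: simple_graph_def)

lemma finite_neighbours: "finite (neighbours a)"
proof (rule finite_subset)
  show "neighbours a \<subseteq> verts G"
    by (auto simp: neighbours_def dest: edge_in_verts)
  show "finite (verts G)"
    using simple by (simp add: simple_graph_def)
qed

lemma colour_inj:
  assumes "{a, v} \<in> edges G" "{a, w} \<in> edges G" "c {a, v} = c {a, w}"
  shows "v = w"
  using proper assms by (fastforce simp: proper_edge_coloring_def doubleton_eq_iff)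

text \<open>The path \<open>w a b d e\<close> is not rainbow, its last three edges have distinct
  colours, and properness separates \<open>aw\<close> from \<open>ab\<close>; so the colour of
  \<open>aw\<close> recurs on \<open>bd\<close> or \<open>de\<close>.\<close>

lemma outside_colour:
  assumes C: "rainbow_C4 G c a b d e" and w: "{a, w} \<in> edges G" "w \<notin> {b, d, e}"
  shows "c {a, w} = c {b, d} \<or> c {a, w} = c {d, e}"
proof -
  have "\<not> rainbow_P4 G c w a b d e" "\<not> rainbow_P4 G c w a e d b"
    using free simple by (simp_all add: rainbow_copies_P4_empty_iff)
  moreover have "c {a, w} \<noteq> c {a, b}" "c {a, w} \<noteq> c {a, e}"
    using C w colour_inj[of a w b] colour_inj[of a w e]
    by (auto simp: rainbow_C4_def insert_commute)
  moreover have "w \<noteq> a"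
    using edge_neq w by blast
  moreover have "{w, a} = {a, w}" "{e, a} = {a, e}" "{d, b} = {b, d}" "{e, d} = {d, e}"
    by auto
  ultimately show ?thesis
    using C w unfolding rainbow_P4_def rainbow_C4_def by auto
qed

text \<open>By properness the colour of \<open>aw\<close> determines \<open>w\<close>, so the two
  colours left by \<open>outside_colour\<close> admit at most two neighbours off the cycle. On the
  cycle there are \<open>b\<close>, \<open>e\<close> and, if \<open>ad\<close> is a chord,
  \<open>d\<close>.\<close>

lemma card_neighbours:
  assumes C: "rainbow_C4 G c a b d e"
  shows "card (neighbours a) \<le> 5" "card (neighbours a) \<ge> 5 \<Longrightarrow> {a, d} \<in> edges G"
proof -
  let ?O = "neighbours a - {b, d, e}"
  have "inj_on (\<lambda>w. c {a, w}) ?O"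
    by (auto simp: inj_on_def neighbours_def intro: colour_inj)
  moreover have "(\<lambda>w. c {a, w}) ` ?O \<subseteq> {c {b, d}, c {d, e}}"
    using outside_colour[OF C] by (auto simp: neighbours_def)
  ultimately have "card ?O \<le> card {c {b, d}, c {d, e}}"
    by (intro card_inj_on_le) auto
  then have O: "card ?O \<le> 2"
    by (simp add: card_insert_if split: if_splits)
  have "card (neighbours a) \<le> card ({b, d, e} \<union> ?O)"
    using finite_neighbours by (intro card_mono) auto
  also have "\<dots> \<le> card {b, d, e} + card ?O"
    by (rule card_Un_le)
  also have "\<dots> \<le> 3 + 2"
    using O by (intro add_mono) (simp_all add: card_insert_if)
  finally show "card (neighbours a) \<le> 5" by simp
  show "{a, d} \<in> edges G" if "card (neighbours a) \<ge> 5"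
  proof (rule ccontr)
    assume "{a, d} \<notin> edges G"
    then have "card (neighbours a) \<le> card ({b, e} \<union> ?O)"
      using finite_neighbours by (intro card_mono) (auto simp: neighbours_def)
    also have "\<dots> \<le> card {b, e} + card ?O"
      by (rule card_Un_le)
    also have "\<dots> \<le> 2 + 2"
      using O by (intro add_mono) (simp_all add: card_insert_if)
    finally show False
      using that by simp
  qed
qed

text \<open>At \<open>b\<close>, \<open>outside_colour\<close> leaves only the colours of
  \<open>de\<close> and \<open>ea\<close> for \<open>bw\<close>; the latter is excluded because
  \<open>bw\<close> and \<open>ea\<close> are opposite edges of the second rainbow cycle.\<close>

lemma second_C4_colour:
  assumes "rainbow_C4 G c a b d e" "rainbow_C4 G c a b w e" "w \<noteq> d"
  shows "c {b, w} = c {d, e}"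
  using outside_colour[OF rainbow_C4_rotate[OF assms(1)], of w] assms
  by (auto simp: rainbow_C4_def)

text \<open>Otherwise \<open>bw\<close> and \<open>bw'\<close> would both repeat the colour of
  \<open>de\<close>, against properness at \<open>b\<close>.\<close>

lemma at_most_two_C4s:
  assumes C: "rainbow_C4 G c a b d e" "rainbow_C4 G c a b w e" "rainbow_C4 G c a b w' e"
  shows "w = d \<or> w' = d \<or> w = w'"
proof (rule ccontr)
  assume neq: "\<not> ?thesis"
  then have "c {b, w} = c {b, w'}"
    using second_C4_colour C by metis
  then show False
    using C neq colour_inj[of b w w'] by (simp add: rainbow_C4_def)
qed

text \<open>A chord \<open>aw\<close> could only have the colour of \<open>bd\<close> or
  \<open>de\<close>, but these already occur at \<open>w\<close>, on \<open>ew\<close> and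
  \<open>bw\<close>.\<close>

lemma second_C4_no_chord:
  assumes C: "rainbow_C4 G c a b d e" "rainbow_C4 G c a b w e" and "w \<noteq> d"
  shows "{a, w} \<notin> edges G"
proof
  assume aw: "{a, w} \<in> edges G"
  have "c {a, w} = c {b, d} \<or> c {a, w} = c {d, e}"
    using outside_colour[OF C(1) aw] C(2) \<open>w \<noteq> d\<close> by (auto simp: rainbow_C4_def)
  moreover have "c {b, w} = c {d, e}"
    using second_C4_colour C \<open>w \<noteq> d\<close> by blast
  \<comment> \<open>Reflecting both cycles exchanges the roles of \<open>b\<close> and
    \<open>e\<close>.\<close>
  moreover have "c {e, w} = c {d, b}"
    using second_C4_colour[OF C[THEN rainbow_C4_reflect]] \<open>w \<noteq> d\<close> .
  ultimately have "c {w, a} = c {w, b} \<or> c {w, a} = c {w, e}"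
    by (auto simp: insert_commute)
  then show False
    using C(2) aw colour_inj[of w a b] colour_inj[of w a e]
    by (auto simp: rainbow_C4_def insert_commute)
qed

lemma rainbow_C4s_at_iff:
  "K \<in> rainbow_C4s_at a \<longleftrightarrow> (\<exists>b d e. rainbow_C4 G c a b d e \<and> K = cycle4 a b d e)"
proof
  assume "K \<in> rainbow_C4s_at a"
  then obtain v b d e where K: "rainbow_C4 G c v b d e" "K = cycle4 v b d e" "a \<in> verts K"
    using simple by (auto simp: rainbow_C4s_at_def rainbow_copies_C4)
  then have "a = v \<or> a = b \<or> a = d \<or> a = e"
    by (auto simp: cycle4_def)
  then show "\<exists>b d e. rainbow_C4 G c a b d e \<and> K = cycle4 a b d e"
    using K(1,2) rainbow_C4_rotate cycle4_rotate by metis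
next
  assume "\<exists>b d e. rainbow_C4 G c a b d e \<and> K = cycle4 a b d e"
  then show "K \<in> rainbow_C4s_at a"
    using simple by (auto simp: rainbow_C4s_at_def rainbow_copies_C4 cycle4_def)
qed

section \<open>Counting rainbow 4-cycles at a vertex and in the whole graph\<close>

lemma card_rainbow_C4s_at_le_choose:
  assumes k: "\<And>b e. card {d. rainbow_C4 G c a b d e} \<le> k"
  shows "card (rainbow_C4s_at a) \<le> (card (neighbours a) choose 2) * k"
proof -
  \<comment> \<open>The cycles through \<open>a\<close> are sorted by the pair of neighbours of
    \<open>a\<close> on them; once the pair is fixed, only the opposite vertex remains free.\<close>
  define P where "P = {S. S \<subseteq> neighbours a \<and> card S = 2}"
  define F where "F S = {K \<in> rainbow_C4s_at a. {w. {a, w} \<in> edges K} = S}" for S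
  have ends: "{w. {a, w} \<in> edges (cycle4 a b d e)} = {b, e}" if "rainbow_C4 G c a b d e" for b d e
    using that by (auto simp: rainbow_C4_def cycle4_def doubleton_eq_iff)
  have finP: "finite P"
    using finite_neighbours by (simp add: P_def)
  have F: "finite (F S) \<and> card (F S) \<le> k" if S: "S \<in> P" for S
  proof -
    obtain b e where be: "S = {b, e}"
      using S by (auto simp: P_def card_2_iff)
    let ?D = "{d. rainbow_C4 G c a b d e}"
    \<comment> \<open>An infinite set has \<open>card\<close> 0, so the bound by \<open>k\<close> is
      informative only together with finiteness.\<close>
    have finD: "finite ?D"
    proof (rule finite_subset)
      show "?D \<subseteq> neighbours b"
        by (auto simp: rainbow_C4_def neighbours_def)
    qed (rule finite_neighbours)
    have sub: "F S \<subseteq> (\<lambda>d. cycle4 a b d e) ` ?D"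
    proof
      fix K assume K: "K \<in> F S"
      then obtain b' d e' where C: "rainbow_C4 G c a b' d e'" "K = cycle4 a b' d e'"
        by (auto simp: F_def rainbow_C4s_at_iff)
      then have "{b', e'} = {b, e}"
        using K ends be by (simp add: F_def)
      then have "b' = b \<and> e' = e \<or> b' = e \<and> e' = b"
        by (auto simp: doubleton_eq_iff)
      \<comment> \<open>The pair is unordered; if its members appear swapped, reflecting the cycle
        restores the chosen order.\<close>
      then show "K \<in> (\<lambda>d. cycle4 a b d e) ` ?D"
      proof
        assume "b' = b \<and> e' = e"
        then show ?thesis
          using C by blast
      next
        assume "b' = e \<and> e' = b"
        then show ?thesis
          using rainbow_C4_reflect[OF C(1)] C(2) cycle4_reflect[of a e d b] by auto
      qed
    qed
    then have "card (F S) \<le> card ?D"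
      using finD by (meson card_image_le card_mono finite_imageI le_trans)
    then show ?thesis
      using sub finD k[of b e] by (auto intro: finite_subset)
  qed
  have "rainbow_C4s_at a \<subseteq> (\<Union>S\<in>P. F S)"
  proof
    fix K assume K: "K \<in> rainbow_C4s_at a"
    then obtain b d e where C: "rainbow_C4 G c a b d e" "K = cycle4 a b d e"
      by (auto simp: rainbow_C4s_at_iff)
    then have "{b, e} \<in> P"
      by (auto simp: rainbow_C4_def P_def neighbours_def insert_commute)
    then show "K \<in> (\<Union>S\<in>P. F S)"
      using K C ends by (auto simp: F_def)
  qed
  then have "card (rainbow_C4s_at a) \<le> card (\<Union>S\<in>P. F S)"
    using finP F by (intro card_mono) auto
  also have "\<dots> \<le> (\<Sum>S\<in>P. card (F S))"
    using finP by (rule card_UN_le)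
  also have "\<dots> \<le> (\<Sum>S\<in>P. k)"
    using F by (intro sum_mono) auto
  also have "\<dots> = (card (neighbours a) choose 2) * k"
    using finite_neighbours by (simp add: P_def n_subsets)
  finally show ?thesis .
qed

lemma card_rainbow_C4s_at_le: "card (rainbow_C4s_at a) \<le> 12"
proof (cases "rainbow_C4s_at a = {}")
  case False
  then obtain b d e where C: "rainbow_C4 G c a b d e"
    by (auto simp: rainbow_C4s_at_iff)
  show ?thesis
  proof (cases "card (neighbours a) \<le> 4")
    case True
    have "card {d. rainbow_C4 G c a b d e} \<le> 2" for b e
    proof (rule ccontr)
      assume "\<not> ?thesis"
      then obtain T where "T \<subseteq> {d. rainbow_C4 G c a b d e}" "card T = 3"
        using obtain_subset_with_card_n[of 3 "{d. rainbow_C4 G c a b d e}"] by auto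
      then show False
        using at_most_two_C4s by (fastforce simp: card_3_iff)
    qed
    then have "card (rainbow_C4s_at a) \<le> (card (neighbours a) choose 2) * 2"
      by (rule card_rainbow_C4s_at_le_choose)
    also have "\<dots> \<le> (4 choose 2) * 2"
      using True by (intro mult_right_mono binomial_right_mono) auto
    also have "\<dots> = 12"
      by (simp add: choose_two)
    finally show ?thesis .
  next
    case False
    then have five: "card (neighbours a) = 5"
      using card_neighbours(1)[OF C] by simp
    \<comment> \<open>Degree 5 makes every opposite vertex adjacent to \<open>a\<close>, which
      \<open>second_C4_no_chord\<close> rules out as soon as two cycles share the pair
      \<open>b\<close>, \<open>e\<close>.\<close>
    have "card {d. rainbow_C4 G c a b d e} \<le> 1" for b e
    proof (rule ccontr)
      assume "\<not> ?thesis"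
      then obtain T where "T \<subseteq> {d. rainbow_C4 G c a b d e}" "card T = 2"
        using obtain_subset_with_card_n[of 2 "{d. rainbow_C4 G c a b d e}"] by auto
      then obtain d w where "rainbow_C4 G c a b d e" "rainbow_C4 G c a b w e" "w \<noteq> d"
        by (auto simp: card_2_iff)
      then show False
        using second_C4_no_chord card_neighbours(2) five by fastforce
    qed
    then have "card (rainbow_C4s_at a) \<le> (card (neighbours a) choose 2) * 1"
      by (rule card_rainbow_C4s_at_le_choose)
    then show ?thesis
      by (simp add: five choose_two)
  qed
qed simp

lemma card_rainbow_C4s_le: "card (rainbow_copies G c (cycle_graph 4)) \<le> 3 * card (verts G)"
proof -
  let ?R = "rainbow_copies G c (cycle_graph 4)"
  have finV: "finite (verts G)"
    using simple by (simp add: simple_graph_def)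
  have finR: "finite ?R"
    using simple by (rule finite_rainbow_copies)
  have "card {a \<in> verts G. a \<in> verts K} = 4" if K: "K \<in> ?R" for K
  proof -
    obtain a b d e where C: "rainbow_C4 G c a b d e" "K = cycle4 a b d e"
      using K simple by (auto simp: rainbow_copies_C4)
    then have "{v \<in> verts G. v \<in> verts K} = {a, b, d, e}"
      by (auto simp: cycle4_def rainbow_C4_def dest: edge_in_verts)
    then show ?thesis
      using C by (simp add: rainbow_C4_def)
  qed
  \<comment> \<open>Incidences of vertices with rainbow 4-cycles are counted twice: four for each
    cycle, at most twelve for each vertex.\<close>
  then have "(\<Sum>a\<in>verts G. card {K \<in> ?R. a \<in> verts K}) = 4 * card ?R"
    using finV finR by (intro sum_multicount) auto
  moreover have "(\<Sum>a\<in>verts G. card {K \<in> ?R. a \<in> verts K}) \<le> (\<Sum>a\<in>verts G. 12)"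
    using card_rainbow_C4s_at_le by (intro sum_mono) (simp add: rainbow_C4s_at_def)
  ultimately show ?thesis
    by simp
qed

end

section \<open>The xor colouring of disjoint copies of
  \<open>K\<^sub>4\<^sub>,\<^sub>4\<close>\<close>

unbundle bit_operations_syntax

text \<open>The vertices are grouped into blocks \<open>8q, \<dots>, 8q + 7\<close>, each carrying a \<open>K\<^sub>4\<^sub>,\<^sub>4\<close> with
  sides \<open>8q + r\<close> and \<open>8q + 4 + r\<close> for \<open>r < 4\<close>; the label of a vertex is its residue modulo 4, and
  bitwise exclusive or is the addition of \<open>Z\<^sub>2 \<times> Z\<^sub>2\<close>. Combining \<open>Min\<close> and \<open>Max\<close> is only a way
  to add the labels of the two ends of an unordered edge.\<close>

definition xor_graph :: "nat \<Rightarrow> nat graph" where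
  "xor_graph n = ({..<n},
     {{u, v} | u v. u < n \<and> v < n \<and> u div 8 = v div 8 \<and> u div 4 \<noteq> v div 4})"

definition xor_colour :: "nat set \<Rightarrow> nat" where
  "xor_colour e = (Min e mod 4) XOR (Max e mod 4)"

lemma xor_colour_edge: "xor_colour {u, v} = (u mod 4) XOR (v mod 4)"
  by (simp add: xor_colour_def min_def max_def xor.commute)

lemma edge_xor_graph_iff:
  "{u, v} \<in> edges (xor_graph n) \<longleftrightarrow>
    u < n \<and> v < n \<and> u div 8 = v div 8 \<and> u div 4 \<noteq> v div 4"
  by (auto simp: xor_graph_def doubleton_eq_iff)

lemma simple_xor_graph: "simple_graph (xor_graph n)"
  by (auto simp: simple_graph_def xor_graph_def card_2_iff)

text \<open>A block of eight splits into just two classes of \<open>div 4\<close>, so changing sides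
  twice within a block leads back to the first side.\<close>

lemma same_side:
  fixes u v w :: nat
  assumes "u div 8 = v div 8" "v div 8 = w div 8" "u div 4 \<noteq> v div 4" "v div 4 \<noteq> w div 4"
  shows "u div 4 = w div 4"
proof -
  have "x div 8 = x div 4 div 2" for x :: nat
    by (simp flip: div_mult2_eq)
  moreover have "a = d" if "a div 2 = b div 2" "b div 2 = d div 2" "a \<noteq> b" "b \<noteq> d"
    for a b d :: nat
    using that by linarith
  ultimately show ?thesis
    using assms by metis
qed

lemma xor_left_cancel: "(a::nat) XOR b = a XOR d \<longleftrightarrow> b = d"
  by (metis xor_self_eq xor.assoc xor.left_neutral)

lemma eq_of_div_mod_4: "u div 4 = v div 4 \<Longrightarrow> u mod 4 = v mod 4 \<Longrightarrow> u = (v::nat)"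
  by (metis div_mult_mod_eq)

text \<open>Two edges at \<open>u\<close> end on the same side, and cancelling the label of
  \<open>u\<close> from equal colours gives equal labels; side and label determine the
  vertex.\<close>

lemma proper_xor_colour: "proper_edge_coloring (xor_graph n) xor_colour"
proof -
  have "xor_colour e \<noteq> xor_colour e'"
    if e: "e \<in> edges (xor_graph n)" "e' \<in> edges (xor_graph n)" "e \<noteq> e'" "e \<inter> e' \<noteq> {}" for e e'
  proof
    assume eq: "xor_colour e = xor_colour e'"
    obtain u where u: "u \<in> e" "u \<in> e'"
      using e by blast
    with e(1,2) obtain v w where vw: "e = {u, v}" "e' = {u, w}"
      by (auto simp: xor_graph_def insert_commute)
    then have "v div 4 = w div 4"
      using e(1,2) by (intro same_side[of v u w]) (auto simp: edge_xor_graph_iff)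
    moreover have "v mod 4 = w mod 4"
      using eq by (simp add: vw xor_colour_edge xor_left_cancel)
    ultimately show False
      using eq_of_div_mod_4 vw e(3) by blast
  qed
  then show ?thesis
    by (auto simp: proper_edge_coloring_def)
qed

lemma ball_less_4: "(\<forall>x\<in>{0..<4::nat}. P x) \<longleftrightarrow> P 0 \<and> P 1 \<and> P 2 \<and> P 3"
proof -
  have "{0..<4} = {0, 1, 2, 3::nat}"
    by auto
  then show ?thesis
    by simp
qed

text \<open>Four distinct values exhaust \<open>{0..<4}\<close>, so the sum is always that of 0, 1,
  2, 3. The bounded quantifiers turn the claim into 256 ground instances.\<close>

lemma xor_all_distinct:
  "\<forall>x\<in>{0..<4::nat}. \<forall>y\<in>{0..<4}. \<forall>z\<in>{0..<4}. \<forall>w\<in>{0..<4}. distinct [x, y, z, w] \<longrightarrow>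
     x XOR y XOR (z XOR w) = 0"
  unfolding ball_less_4 by simp

lemma xor_closed: "\<forall>x\<in>{0..<4::nat}. \<forall>y\<in>{0..<4}. x XOR y \<in> {0..<4}"
  unfolding ball_less_4 by simp

lemma no_rainbow_P4_xor: "\<not> rainbow_P4 (xor_graph n) xor_colour a b d e f"
proof
  assume P: "rainbow_P4 (xor_graph n) xor_colour a b d e f"
  \<comment> \<open>Every edge changes sides, so every second vertex of the path is on the same side
    of the same block.\<close>
  then have "a div 4 = d div 4" "d div 4 = f div 4"
    by (auto simp: rainbow_P4_def edge_xor_graph_iff intro: same_side[of a b d] same_side[of d e f])
  moreover have "a mod 4 = f mod 4"
  proof -
    let ?a = "a mod 4" and ?b = "b mod 4" and ?d = "d mod 4" and ?e = "e mod 4" and ?f = "f mod 4"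
    \<comment> \<open>The four distinct colours sum to 0, while the inner labels cancel in pairs and
      leave the two end labels.\<close>
    have "(?a XOR ?b) XOR (?b XOR ?d) XOR ((?d XOR ?e) XOR (?e XOR ?f)) = 0"
      using P xor_closed by (intro xor_all_distinct[rule_format])
        (auto simp: rainbow_P4_def xor_colour_edge)
    moreover have "x XOR (x XOR y) = y" for x y :: nat
      by (simp flip: xor.assoc)
    ultimately have "?a XOR ?f = 0"
      by (simp add: xor.assoc)
    then show ?thesis
      by (metis xor_left_cancel xor_self_eq)
  qed
  ultimately have "a = f"
    using eq_of_div_mod_4 by metis
  then show False
    using P by (simp add: rainbow_P4_def)
qed

section \<open>Rainbow 4-cycles inside the blocks\<close>

lemma
  assumes "r < (4::nat)"
  shows block_div_mod: "(8 * q + r) mod 4 = r" "(8 * q + 4 + r) mod 4 = r"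
    "(8 * q + r) div 8 = q" "(8 * q + 4 + r) div 8 = q"
    "(8 * q + r) div 4 = 2 * q" "(8 * q + 4 + r) div 4 = 2 * q + 1"
proof -
  have *: "8 * q + r = r + 4 * (2 * q)" "8 * q + 4 + r = r + 4 * (2 * q + 1)"
    by simp_all
  show "(8 * q + r) mod 4 = r" "(8 * q + 4 + r) mod 4 = r"
    "(8 * q + r) div 4 = 2 * q" "(8 * q + 4 + r) div 4 = 2 * q + 1"
    unfolding * mod_mult_self2 using assms by (simp_all del: distrib_left_numeral)
  show "(8 * q + r) div 8 = q" "(8 * q + 4 + r) div 8 = q"
    using assms by (auto intro: div_nat_eqI)
qed

text \<open>Opposite edges of the 4-cycle with labels \<open>a, x, b, y\<close> in order have equal colours iff
  \<open>a + b = x + y\<close>; the order constraints pick one labelling of each cycle.\<close>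

definition quads :: "(nat \<times> nat \<times> nat \<times> nat) set" where
  "quads = set (filter (\<lambda>(a, b, x, y). a < b \<and> x < y \<and> a XOR b \<noteq> x XOR y)
     (List.product [0..<4] (List.product [0..<4] (List.product [0..<4] [0..<4]))))"

lemma upt_0_4: "[0..<4] = [0, 1, 2, 3]"
  by (simp add: upt_rec)

text \<open>There are \<open>6 * 6\<close> choices of two pairs of labels. Each pair has the same
  sum as exactly two pairs, itself and its complement, so 12 choices drop out.\<close>

lemma card_quads: "card quads = 24"
  unfolding quads_def upt_0_4 by (subst distinct_card) (simp_all add: distinct_product)

lemma rainbow_quads:
  "\<forall>(a, b, x, y)\<in>quads. distinct [a XOR x, x XOR b, b XOR y, y XOR a]"
  unfolding quads_def upt_0_4 by simp

fun quad_cycle :: "nat \<times> nat \<times> nat \<times> nat \<times> nat \<Rightarrow> nat graph" where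
  "quad_cycle (q, a, b, x, y) = cycle4 (8 * q + a) (8 * q + 4 + x) (8 * q + b) (8 * q + 4 + y)"

lemma inj_quad_cycle: "inj_on quad_cycle (UNIV \<times> quads)"
proof (rule inj_onI)
  fix s t
  assume st: "s \<in> UNIV \<times> quads" "t \<in> UNIV \<times> quads" "quad_cycle s = quad_cycle t"
  obtain q a b x y q' a' b' x' y' where s: "s = (q, a, b, x, y)" and t: "t = (q', a', b', x', y')"
    by (metis prod.exhaust_sel)
  have quads: "(a, b, x, y) \<in> quads" "(a', b', x', y') \<in> quads"
    and eq: "quad_cycle (q, a, b, x, y) = quad_cycle (q', a', b', x', y')"
    using st by (simp_all only: s t mem_Times_iff fst_conv snd_conv)
  \<comment> \<open>The order constraints make both lists strictly increasing, so the vertex set of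
    the cycle already determines them.\<close>
  let ?l = "[8 * q + a, 8 * q + b, 8 * q + 4 + x, 8 * q + 4 + y]"
  let ?l' = "[8 * q' + a', 8 * q' + b', 8 * q' + 4 + x', 8 * q' + 4 + y']"
  have lt: "a < b" "b < 4" "x < y" "y < 4" "a' < b'" "b' < 4" "x' < y'" "y' < 4"
    using quads by (auto simp: quads_def)
  have "set ?l = verts (quad_cycle (q, a, b, x, y))"
    "set ?l' = verts (quad_cycle (q', a', b', x', y'))"
    by (auto simp: cycle4_def)
  then have "set ?l = set ?l'"
    using eq by simp
  then have "?l = ?l'"
    using lt by (intro sorted_distinct_set_unique) auto
  then have *: "8 * q + a = 8 * q' + a'" "8 * q + b = 8 * q' + b'"
    "8 * q + x = 8 * q' + x'" "8 * q + y = 8 * q' + y'"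
    by auto
  then have "q = q'"
    using lt by linarith
  then show "s = t"
    using * by (simp add: s t)
qed

lemma quad_cycle_rainbow:
  assumes "q < m" "t \<in> quads"
  shows "quad_cycle (q, t) \<in> rainbow_copies (xor_graph (8 * m)) xor_colour (cycle_graph 4)"
proof -
  obtain a b x y where t: "t = (a, b, x, y)"
    by (cases t)
  have lt: "a < b" "b < 4" "x < y" "y < 4"
    using assms by (auto simp: quads_def t)
  have "distinct [a XOR x, x XOR b, b XOR y, y XOR a]"
    using bspec[OF rainbow_quads assms(2)] by (simp add: t)
  moreover have "8 * q + r < 8 * m" "8 * q + 4 + r < 8 * m" if "r < 4" for r
    using that assms(1) by linarith+
  ultimately have "rainbow_C4 (xor_graph (8 * m)) xor_colour
      (8 * q + a) (8 * q + 4 + x) (8 * q + b) (8 * q + 4 + y)"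
    using lt unfolding rainbow_C4_def
    by (simp add: edge_xor_graph_iff xor_colour_edge block_div_mod)
  then show ?thesis
    using simple_xor_graph by (auto simp: rainbow_copies_C4 t)
qed

lemma card_rainbow_C4s_xor:
  "24 * m \<le> card (rainbow_copies (xor_graph (8 * m)) xor_colour (cycle_graph 4))"
proof -
  let ?R = "rainbow_copies (xor_graph (8 * m)) xor_colour (cycle_graph 4)"
  have "finite ?R"
    using simple_xor_graph by (rule finite_rainbow_copies)
  moreover have "quad_cycle ` ({..<m} \<times> quads) \<subseteq> ?R"
    using quad_cycle_rainbow by auto
  moreover have "inj_on quad_cycle ({..<m} \<times> quads)"
    using inj_quad_cycle by (rule inj_on_subset) auto
  ultimately have "card ({..<m} \<times> quads) \<le> card ?R"
    by (intro card_inj_on_le) auto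
  then show ?thesis
    by (simp add: card_cartesian_product card_quads)
qed

theorem theorem9:
  fixes n :: nat
  assumes "n > 0" and "8 dvd n"
  shows "ex_star n (cycle_graph 4) (path_graph 4) = 3 * n"
proof -
  obtain m where n: "n = 8 * m"
    using \<open>8 dvd n\<close> by blast
  have bound: "k \<le> 3 * n" if "k \<in> ex_star_values n (cycle_graph 4) (path_graph 4)" for k
    using that rainbow_P4_free.card_rainbow_C4s_le
    by (fastforce simp: ex_star_values_def rainbow_P4_free_def)
  let ?k = "card (rainbow_copies (xor_graph n) xor_colour (cycle_graph 4))"
  have "rainbow_copies (xor_graph n) xor_colour (path_graph 4) = {}"
    using no_rainbow_P4_xor simple_xor_graph by (simp add: rainbow_copies_P4_empty_iff)
  moreover have "card (verts (xor_graph n)) = n"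
    by (simp add: xor_graph_def)
  ultimately have k: "?k \<in> ex_star_values n (cycle_graph 4) (path_graph 4)"
    using simple_xor_graph proper_xor_colour unfolding ex_star_values_def by blast
  \<comment> \<open>The two bounds meet, as \<open>24 * m = 3 * (8 * m)\<close>.\<close>
  moreover have "?k = 3 * n"
    using bound[OF k] card_rainbow_C4s_xor[of m] n by simp
  ultimately show ?thesis
    using bound unfolding ex_star_def by (intro Max_eqI finite_ex_star_values) auto
qed

end
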